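(* Let $r \ge 2$ be an integer and let $n$ be a positive rational number. Let $E_1, \ldots, E_{\lceil rn \rceil}$ be (not necessarily distinct) sets of edges of an $r$-uniform hypergraph such that $\nu^*(E_i) \ge n$ for every $i = 1, \ldots, \lceil rn \rceil$. Then the family $E_1,\ldots,E_{\lceil rn\rceil}$ has a rainbow fractional matching of size $n$.
   Context: An $r$-uniform hypergraph has edges that are $r$-element subsets of a finite vertex set. For a set $E$ of edges, a fractional matching for $E$ is a function $f\colon E \to \mathbb{R}_{\ge 0}$ such that $\sum_{e \in E,\, e \ni v} f(e) \le 1$ for every vertex $v$; its size is $\sum_{e\in E} f(e)$. The fractional matching number $\nu^*(E)$ is the maximum size of a fractional matching for $E$. Given a family $E_1,\ldots,E_m$ of sets of edges, a rainbow fractional matching of size $n$ is a set of edges $\{e_1,\ldots,e_k\}$ with $e_j \in E_{\sigma(j)}$ for $j=1,\ldots,k$, where $\sigma(1),\ldots,\sigma(k)$ are distinct indices, together with a fractional matching $f\colon\{e_1,\ldots,e_k\}\to\mathbb{R}_{\ge 0}$ of size $n$. *)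

theory Defs
  imports "HOL-Analysis.Analysis"
begin

definition uniform_hypergraph :: "nat \<Rightarrow> 'a set \<Rightarrow> 'a set set \<Rightarrow> bool" where
  "uniform_hypergraph r V H \<longleftrightarrow> finite V \<and> (\<forall>e\<in>H. e \<subseteq> V \<and> card e = r)"

text \<open>
  A function from \<open>E\<close> to the nonnegative reals is a total function of which only
  the values on \<open>E\<close> matter.
\<close>

definition fractional_matching :: "'a set \<Rightarrow> 'a set set \<Rightarrow> ('a set \<Rightarrow> real) \<Rightarrow> bool" where
  "fractional_matching V E f \<longleftrightarrow>
     (\<forall>e\<in>E. 0 \<le> f e) \<and> (\<forall>v\<in>V. (\<Sum>e\<in>{e \<in> E. v \<in> e}. f e) \<le> 1)"

definition fractional_size :: "'a set set \<Rightarrow> ('a set \<Rightarrow> real) \<Rightarrow> real" where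
  "fractional_size E f = (\<Sum>e\<in>E. f e)"

text \<open>
  The supremum below is a maximum for edge sets of \<open>r\<close>-uniform hypergraphs with
  \<open>r > 0\<close>, see \<open>fractional_matching_number_attained\<close>.
\<close>

definition fractional_matching_number :: "'a set \<Rightarrow> 'a set set \<Rightarrow> real" where
  "fractional_matching_number V E =
     Sup {fractional_size E f | f. fractional_matching V E f}"

text \<open>The edges \<open>e 1, \<dots>, e k\<close> may coincide; the matching lives on the set they form.\<close>

definition has_rainbow_fractional_matching ::
    "'a set \<Rightarrow> nat \<Rightarrow> (nat \<Rightarrow> 'a set set) \<Rightarrow> real \<Rightarrow> bool" where
  "has_rainbow_fractional_matching V m E s \<longleftrightarrow>
     (\<exists>(k::nat) e \<sigma> f.
        inj_on \<sigma> {1..k} \<and>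
        (\<forall>j\<in>{1..k}. \<sigma> j \<in> {1..m} \<and> e j \<in> E (\<sigma> j)) \<and>
        fractional_matching V (e ` {1..k}) f \<and>
        fractional_size (e ` {1..k}) f = s)"

lemma fractional_matching_number_attained:
  assumes H: "uniform_hypergraph r V E" and r: "r > 0"
  shows "\<exists>f. fractional_matching V E f \<and>
             fractional_size E f = fractional_matching_number V E \<and>
             (\<forall>g. fractional_matching V E g \<longrightarrow> fractional_size E g \<le> fractional_size E f)"
proof -
  have fV: "finite V" and EV: "\<And>e. e \<in> E \<Longrightarrow> e \<subseteq> V \<and> card e = r"
    using H by (auto simp: uniform_hypergraph_def)
  have fE: "finite E"
    by (rule finite_subset[of _ "Pow V"]) (use EV fV in auto)
  define B where "B = (\<lambda>e. if e \<in> E then {0..1::real} else {0})"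
  define K where "K = PiE UNIV B \<inter>
    (\<Inter>v\<in>V. {f. (\<Sum>e\<in>{e \<in> E. v \<in> e}. f e) \<le> (1::real)})"
  have "compact (PiE UNIV B)"
    using compactin_PiE[of "\<lambda>_. euclidean" UNIV B]
    by (simp add: euclidean_product_topology B_def)
  moreover have "closed {f. (\<Sum>e\<in>{e \<in> E. v \<in> e}. f e) \<le> (1::real)}" for v
    by (intro closed_Collect_le continuous_intros continuous_on_coordinatewise_then_product)
       auto
  ultimately have cK: "compact K"
    unfolding K_def by (intro compact_Int_closed closed_INT) auto
  have "(\<lambda>_. 0) \<in> K" by (auto simp: K_def B_def)
  then have "K \<noteq> {}" by auto
  moreover have "continuous_on K (\<lambda>f. fractional_size E f)"
    unfolding fractional_size_def
    by (intro continuous_on_sum continuous_on_subset[OF continuous_on_product_coordinates]) auto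
  ultimately obtain f where f: "f \<in> K"
      "\<And>g. g \<in> K \<Longrightarrow> fractional_size E g \<le> fractional_size E f"
    using continuous_attains_sup[OF cK] by metis
  have fm: "fractional_matching V E f"
    using f(1) by (auto simp: K_def B_def fractional_matching_def PiE_iff Pi_iff
        split: if_splits)
  have max: "fractional_size E g \<le> fractional_size E f" if g: "fractional_matching V E g" for g
  proof -
    define h where "h = (\<lambda>e. if e \<in> E then g e else 0)"
    have "g e \<le> 1" if e: "e \<in> E" for e
    proof -
      from EV[OF e] r obtain v where v: "v \<in> e" "v \<in> V"
        by (metis card.empty less_irrefl subset_iff ex_in_conv)
      have "g e \<le> (\<Sum>e\<in>{e \<in> E. v \<in> e}. g e)"
        by (rule member_le_sum) (use g e v fE in \<open>auto simp: fractional_matching_def\<close>)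
      also have "\<dots> \<le> 1" using g v by (auto simp: fractional_matching_def)
      finally show ?thesis .
    qed
    moreover have "(\<Sum>e\<in>{e \<in> E. v \<in> e}. h e) = (\<Sum>e\<in>{e \<in> E. v \<in> e}. g e)" for v
      by (rule sum.cong) (auto simp: h_def)
    ultimately have "h \<in> K"
      using g by (auto simp: K_def B_def h_def fractional_matching_def PiE_iff)
    moreover have "fractional_size E h = fractional_size E g"
      by (simp add: fractional_size_def h_def)
    ultimately show ?thesis using f(2) by metis
  qed
  have "fractional_matching_number V E = fractional_size E f"
    unfolding fractional_matching_number_def
    by (rule cSup_eq_maximum) (use fm max in auto)
  then show ?thesis using fm max by metis
qed

end

theory Submission
  imports Defs
begin

text \<open>
  The argument follows Lovasz's proof of the colorful Helly theorem, applied to the polyhedra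
  of fractional covers. Write \<open>m = \<lceil>r n\<rceil>\<close> and suppose that every rainbow selection \<open>K\<close> of \<open>m\<close>
  edges has \<open>\<nu>\<^sup>*(K) < n\<close>. Minimize \<open>\<Sum>\<^sub>v w(v) + \<epsilon> w(v)\<^sup>2\<close> over the fractional covers \<open>w\<close> of \<open>K\<close>;
  the quadratic term makes the minimizer unique. The optimality conditions give dual weights on
  the edges, of total less than \<open>n\<close> for small \<open>\<epsilon>\<close>, whose support is by Caratheodory at most the
  number of vertices with tight dual constraint. The dual degree of such a vertex is at
  least 1, so there are fewer than \<open>r n \<le> m\<close> of them, and the minimum over \<open>K\<close> is already the
  minimum over a rainbow subfamily of fewer than \<open>m\<close> edges. Now choose a rainbow selection of \<open>m - 1\<close> edges
  whose minimum is largest, with minimizer \<open>W\<close>, and let \<open>E\<^sub>i\<close> be the set it omits. Adding any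
  edge of \<open>E\<^sub>i\<close> cannot increase the minimum, so by uniqueness \<open>W\<close> covers that edge. Hence \<open>W\<close>
  is a fractional cover of \<open>E\<^sub>i\<close> of total weight less than \<open>n\<close>, contradicting \<open>\<nu>\<^sup>*(E\<^sub>i) \<ge> n\<close>.
\<close>

section \<open>Linear algebra: dependence, conic Caratheodory, Farkas\<close>

text \<open>Gaussian elimination, one coordinate at a time: a vector \<open>a p\<close> with nonzero
  entry at \<open>u\<close> clears that entry in the others, and a relation among the cleared
  vectors lifts back.\<close>

lemma nontrivial_relation:
  fixes a :: "'i \<Rightarrow> 'a \<Rightarrow> real"
  assumes "finite V" "finite I" "card V < card I"
  shows "\<exists>c. (\<exists>i\<in>I. c i \<noteq> 0) \<and> (\<forall>v\<in>V. (\<Sum>i\<in>I. c i * a i v) = 0)"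
  using assms
proof (induction V arbitrary: I a rule: finite_induct)
  case empty
  then obtain i where "i \<in> I" by fastforce
  then show ?case by (intro exI[of _ "\<lambda>_. 1"]) auto
next
  case (insert u V)
  show ?case
  proof (cases "\<forall>i\<in>I. a i u = 0")
    case True
    have "card V < card I" using insert by simp
    then obtain c where "\<exists>i\<in>I. c i \<noteq> 0" "\<forall>v\<in>V. (\<Sum>i\<in>I. c i * a i v) = 0"
      using insert.IH[OF insert.prems(1)] by blast
    with True show ?thesis by (intro exI[of _ c]) auto
  next
    case False
    then obtain p where p: "p \<in> I" "a p u \<noteq> 0" by blast
    define J where "J = I - {p}"
    have J: "finite J" "p \<notin> J" "I = insert p J" using insert.prems p by (auto simp: J_def)
    then have "card V < card J" using insert by simp
    from insert.IH[OF J(1) this, of "\<lambda>i v. a i v - a i u / a p u * a p v"]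
    obtain c where c: "\<exists>i\<in>J. c i \<noteq> 0"
      "\<And>v. v \<in> V \<Longrightarrow> (\<Sum>i\<in>J. c i * (a i v - a i u / a p u * a p v)) = 0" by blast
    \<comment> \<open>Undoes the elimination: \<open>k\<close> collects the multiples of
      \<open>a p\<close> that were subtracted, weighted by \<open>c\<close>.\<close>
    define k where "k = - (\<Sum>i\<in>J. c i * a i u) / a p u"
    have sum_eq: "(\<Sum>i\<in>I. (c(p := k)) i * a i v) = k * a p v + (\<Sum>i\<in>J. c i * a i v)" for v
      using J by (auto intro!: sum.cong)
    have "(\<Sum>i\<in>I. (c(p := k)) i * a i v) = 0" if "v \<in> V" for v
    proof -
      have "(\<Sum>i\<in>J. c i * (a i v - a i u / a p u * a p v))
          = (\<Sum>i\<in>J. c i * a i v) - (\<Sum>i\<in>J. c i * a i u) / a p u * a p v"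
        by (simp add: right_diff_distrib sum_subtractf sum_distrib_right sum_divide_distrib
            mult.assoc)
      moreover have "k * a p v = - ((\<Sum>i\<in>J. c i * a i u) / a p u * a p v)"
        by (simp add: k_def)
      ultimately show ?thesis using c(2)[OF that] sum_eq[of v] by linarith
    qed
    moreover have "(\<Sum>i\<in>I. (c(p := k)) i * a i u) = 0"
      unfolding sum_eq using p by (simp add: k_def)
    moreover have "\<exists>i\<in>I. (c(p := k)) i \<noteq> 0" using c(1) J by auto
    ultimately show ?thesis by (intro exI[of _ "c(p := k)"]) blast
  qed
qed

text \<open>While the support has more than \<open>card V\<close> indices, its vectors are
  dependent; subtracting a suitable multiple of the relation drops an index, keeps the sum and
  leaves all coefficients nonnegative.\<close>

lemma conic_caratheodory:
  fixes a :: "'i \<Rightarrow> 'a \<Rightarrow> real"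
  assumes "finite V" "finite I" "\<And>i. i \<in> I \<Longrightarrow> 0 \<le> l i"
  shows "\<exists>k. (\<forall>i\<in>I. 0 \<le> k i) \<and> (\<forall>v\<in>V. (\<Sum>i\<in>I. k i * a i v) = (\<Sum>i\<in>I. l i * a i v))
           \<and> card {i\<in>I. k i \<noteq> 0} \<le> card V"
  using assms(3)
proof (induction "card {i\<in>I. l i \<noteq> 0}" arbitrary: l rule: less_induct)
  case less
  define S where "S = {i\<in>I. l i \<noteq> 0}"
  have S: "finite S" "S \<subseteq> I" using assms by (auto simp: S_def)
  have pos: "0 < l i" if "i \<in> S" for i using that less.prems[of i] by (force simp: S_def)
  show ?case
  proof (cases "card S \<le> card V")
    case True
    then show ?thesis using less.prems S_def by blast
  next
    case False
    then obtain c0 where c0: "\<exists>i\<in>S. c0 i \<noteq> 0" "\<forall>v\<in>V. (\<Sum>i\<in>S. c0 i * a i v) = 0"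
      using nontrivial_relation[OF assms(1) S(1), of a] by auto
    obtain c where c: "\<exists>i\<in>S. c i > 0" "\<forall>v\<in>V. (\<Sum>i\<in>S. c i * a i v) = 0"
    proof (cases "\<exists>i\<in>S. c0 i > 0")
      case True
      then show ?thesis using c0 that by blast
    next
      case False
      then have "\<exists>i\<in>S. - c0 i > 0" using c0(1) by force
      moreover have "\<forall>v\<in>V. (\<Sum>i\<in>S. - c0 i * a i v) = 0" using c0(2) by (simp add: sum_negf)
      ultimately show ?thesis using that[of "\<lambda>i. - c0 i"] by blast
    qed
    define P where "P = {i\<in>S. c i > 0}"
    have P: "finite P" "P \<noteq> {}" using S c by (auto simp: P_def)
    \<comment> \<open>Ratio test: the coefficient of \<open>p\<close> is a first one to reach 0 when
      growing multiples of \<open>c\<close> are subtracted.\<close>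
    obtain p where p: "p \<in> P" "\<And>i. i \<in> P \<Longrightarrow> l p / c p \<le> l i / c i"
      using ex_min_if_finite[of "(\<lambda>i. l i / c i) ` P"] P by (force simp: not_less)
    define t where "t = l p / c p"
    have t: "t > 0" using p pos by (auto simp: t_def P_def)
    define k where "k i = (if i \<in> S then l i - t * c i else 0)" for i
    have k0: "0 \<le> k i" for i
    proof (cases "i \<in> P")
      case True
      then show ?thesis using p(2)[OF True] by (auto simp: k_def t_def P_def field_simps)
    next
      case False
      then have "i \<in> S \<Longrightarrow> t * c i \<le> 0" using t by (auto simp: P_def mult_le_0_iff)
      then show ?thesis using pos[of i] by (auto simp: k_def)
    qed
    have "p \<in> S" "k p = 0" using p by (auto simp: P_def k_def t_def)
    then have "{i\<in>I. k i \<noteq> 0} \<subset> S" using S by (auto simp: k_def)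
    then have "card {i\<in>I. k i \<noteq> 0} < card {i\<in>I. l i \<noteq> 0}"
      using psubset_card_mono S by (metis S_def)
    from less.hyps[OF this k0] obtain k' where k': "\<forall>i\<in>I. 0 \<le> k' i"
      "\<forall>v\<in>V. (\<Sum>i\<in>I. k' i * a i v) = (\<Sum>i\<in>I. k i * a i v)"
      "card {i\<in>I. k' i \<noteq> 0} \<le> card V" by blast
    have "(\<Sum>i\<in>I. k i * a i v) = (\<Sum>i\<in>I. l i * a i v)" if "v \<in> V" for v
    proof -
      have "(\<Sum>i\<in>I. k i * a i v) = (\<Sum>i\<in>S. k i * a i v)"
        by (rule sum.mono_neutral_right) (use S assms in \<open>auto simp: k_def\<close>)
      also have "\<dots> = (\<Sum>i\<in>S. l i * a i v) - t * (\<Sum>i\<in>S. c i * a i v)"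
        by (simp add: k_def left_diff_distrib sum_subtractf sum_distrib_left mult.assoc)
      also have "\<dots> = (\<Sum>i\<in>S. l i * a i v)" using c(2) that by simp
      also have "\<dots> = (\<Sum>i\<in>I. l i * a i v)"
        by (rule sum.mono_neutral_left) (use S assms in \<open>auto simp: S_def\<close>)
      finally show ?thesis .
    qed
    then show ?thesis using k' by auto
  qed
qed

text \<open>
  Bartl's induction on the number of generators: if the last generator \<open>a p\<close> is needed,
  some \<open>z\<close> has \<open>\<langle>a p, z\<rangle> = -1\<close>, and projecting along \<open>z\<close> eliminates \<open>a p\<close>.
\<close>

lemma farkas:
  fixes a :: "'i \<Rightarrow> 'a \<Rightarrow> real"
  assumes "finite V" "finite I"
    and "\<And>x. (\<And>i. i \<in> I \<Longrightarrow> 0 \<le> (\<Sum>v\<in>V. a i v * x v)) \<Longrightarrow> 0 \<le> (\<Sum>v\<in>V. b v * x v)"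
  shows "\<exists>l. (\<forall>i\<in>I. 0 \<le> l i) \<and> (\<forall>v\<in>V. b v = (\<Sum>i\<in>I. l i * a i v))"
  using assms(2,3)
proof (induction I arbitrary: a b rule: finite_induct)
  case empty
  \<comment> \<open>With no generators the hypothesis may be tested at \<open>-b\<close>.\<close>
  from empty[of "\<lambda>v. - b v"] have "(\<Sum>v\<in>V. b v * b v) \<le> 0" by (simp add: sum_negf)
  then have "(\<Sum>v\<in>V. b v * b v) = 0" by (simp add: antisym sum_nonneg)
  then have "\<forall>v\<in>V. b v = 0" using assms(1) by (simp add: sum_nonneg_eq_0_iff)
  then show ?case by auto
next
  case (insert p I)
  let ?ip = "\<lambda>c x. \<Sum>v\<in>V. c v * x v"
  show ?case
  proof (cases "\<forall>x. (\<forall>i\<in>I. 0 \<le> ?ip (a i) x) \<longrightarrow> 0 \<le> ?ip b x")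
    case True
    then obtain l where l: "\<forall>i\<in>I. 0 \<le> l i" "\<forall>v\<in>V. b v = (\<Sum>i\<in>I. l i * a i v)"
      using insert.IH[of a b] by blast
    have "(\<Sum>i\<in>I. (l(p := 0)) i * a i v) = (\<Sum>i\<in>I. l i * a i v)" for v
      by (rule sum.cong) (use insert.hyps in auto)
    then show ?thesis using l insert.hyps by (intro exI[of _ "l(p := 0)"]) auto
  next
    case False
    then obtain y where y: "\<And>i. i \<in> I \<Longrightarrow> 0 \<le> ?ip (a i) y" "?ip b y < 0" by force
    have yp: "?ip (a p) y < 0" using insert.prems[of y] y by force
    define s where "s = - (1 / ?ip (a p) y)"
    have s: "s > 0" "s * ?ip (a p) y = -1" using yp by (auto simp: s_def)
    define z where "z v = s * y v" for v
    have zip: "?ip c z = s * ?ip c y" for c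
      by (simp add: z_def sum_distrib_left mult.left_commute)
    have z: "0 \<le> ?ip (a i) z" if "i \<in> I" for i
      unfolding zip using y(1)[OF that] s by simp
    have zb: "?ip b z < 0" unfolding zip using y(2) s by (simp add: mult_pos_neg)
    have zp: "?ip (a p) z = -1" unfolding zip using s by simp
    have ipz: "?ip (\<lambda>v. c v + k * a p v) x = ?ip c x + k * ?ip (a p) x" for c k x
      by (simp add: distrib_right sum.distrib sum_distrib_left mult.assoc)
    have shift: "?ip c (\<lambda>v. x v + k * z v) = ?ip c x + k * ?ip c z" for c k x
      by (simp add: distrib_left sum.distrib sum_distrib_left mult.left_commute)
    \<comment> \<open>Pairing \<open>x\<close> with a projected vector equals pairing the original
      vector with \<open>?x\<close>, and \<open>?x\<close> is orthogonal to
      \<open>a p\<close>.\<close>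
    have "0 \<le> ?ip (\<lambda>v. b v + ?ip b z * a p v) x"
      if x: "\<And>i. i \<in> I \<Longrightarrow> 0 \<le> ?ip (\<lambda>v. a i v + ?ip (a i) z * a p v) x" for x
    proof -
      let ?x = "\<lambda>v. x v + ?ip (a p) x * z v"
      have "0 \<le> ?ip b ?x"
      proof (rule insert.prems)
        fix i assume "i \<in> insert p I"
        then show "0 \<le> ?ip (a i) ?x"
          using x[of i] zp unfolding ipz shift by (auto simp: mult.commute)
      qed
      then show ?thesis unfolding ipz shift by (simp add: mult.commute)
    qed
    then obtain l where l: "\<forall>i\<in>I. 0 \<le> l i"
      "\<forall>v\<in>V. b v + ?ip b z * a p v = (\<Sum>i\<in>I. l i * (a i v + ?ip (a i) z * a p v))"
      using insert.IH[of "\<lambda>i v. a i v + ?ip (a i) z * a p v" "\<lambda>v. b v + ?ip b z * a p v"]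
      by blast
    \<comment> \<open>Solving for \<open>b\<close> gathers all multiples of \<open>a p\<close> in
      \<open>k\<close>, which is nonnegative because \<open>z\<close> pairs nonnegatively with the
      other generators and negatively with \<open>b\<close>.\<close>
    define k where "k = (\<Sum>i\<in>I. l i * ?ip (a i) z) - ?ip b z"
    have "0 \<le> (\<Sum>i\<in>I. l i * ?ip (a i) z)" using l z by (intro sum_nonneg) auto
    then have "0 \<le> k" using zb by (simp add: k_def)
    moreover have "b v = (\<Sum>i\<in>insert p I. (l(p := k)) i * a i v)" if "v \<in> V" for v
    proof -
      have "(\<Sum>i\<in>insert p I. (l(p := k)) i * a i v) = k * a p v + (\<Sum>i\<in>I. l i * a i v)"
        using insert.hyps by (auto intro!: sum.cong)
      moreover have "(\<Sum>i\<in>I. l i * (a i v + ?ip (a i) z * a p v))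
          = (\<Sum>i\<in>I. l i * a i v) + (\<Sum>i\<in>I. l i * ?ip (a i) z) * a p v"
        by (simp add: distrib_left sum.distrib sum_distrib_right mult.assoc)
      moreover note bspec[OF l(2) that]
      ultimately show ?thesis unfolding k_def left_diff_distrib by linarith
    qed
    ultimately show ?thesis using l(1) by (intro exI[of _ "l(p := k)"]) auto
  qed
qed

section \<open>Fractional covers and the strictly convex cost\<close>

definition fractional_cover :: "'a set \<Rightarrow> 'a set set \<Rightarrow> ('a \<Rightarrow> real) \<Rightarrow> bool" where
  "fractional_cover V K w \<longleftrightarrow> (\<forall>v\<in>V. 0 \<le> w v) \<and> (\<forall>e\<in>K. 1 \<le> sum w e)"

definition cover_cost :: "'a set \<Rightarrow> real \<Rightarrow> ('a \<Rightarrow> real) \<Rightarrow> real" where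
  "cover_cost V \<epsilon> w = (\<Sum>v\<in>V. w v + \<epsilon> * (w v)\<^sup>2)"

definition optimal_cover :: "'a set \<Rightarrow> 'a set set \<Rightarrow> real \<Rightarrow> ('a \<Rightarrow> real) \<Rightarrow> bool" where
  "optimal_cover V K \<epsilon> w \<longleftrightarrow> fractional_cover V K w \<and>
     (\<forall>u. fractional_cover V K u \<longrightarrow> cover_cost V \<epsilon> w \<le> cover_cost V \<epsilon> u)"

lemma fractional_cover_antimono:
  "fractional_cover V K w \<Longrightarrow> L \<subseteq> K \<Longrightarrow> fractional_cover V L w"
  by (auto simp: fractional_cover_def)

text \<open>The exact second-order Taylor expansion along \<open>d\<close>; with one factor
  \<open>t\<close> pulled out, the bracket decides the sign of the change for positive
  steps.\<close>

lemma cover_cost_add: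
  "cover_cost V \<epsilon> (\<lambda>v. w v + t * d v) =
     cover_cost V \<epsilon> w + t * ((\<Sum>v\<in>V. (1 + 2 * \<epsilon> * w v) * d v) + t * (\<epsilon> * (\<Sum>v\<in>V. (d v)\<^sup>2)))"
  unfolding cover_cost_def sum_distrib_left sum.distrib[symmetric]
  by (rule sum.cong) (auto simp: power2_eq_square algebra_simps)

lemma cover_cost_tangent:
  assumes "0 \<le> \<epsilon>"
  shows "cover_cost V \<epsilon> w + (\<Sum>v\<in>V. (1 + 2 * \<epsilon> * w v) * (u v - w v)) \<le> cover_cost V \<epsilon> u"
  using cover_cost_add[of V \<epsilon> w 1 "\<lambda>v. u v - w v"] assms by (simp add: sum_nonneg)

text \<open>Strict convexity: the midpoint of two minimizers that differ on \<open>V\<close> would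
  be cheaper than both. Values outside \<open>V\<close> do not enter the cost, so nothing is claimed
  there.\<close>

lemma optimal_cover_unique:
  assumes V: "finite V" and \<epsilon>: "0 < \<epsilon>" and K: "\<And>e. e \<in> K \<Longrightarrow> e \<subseteq> V"
    and w: "optimal_cover V K \<epsilon> w"
    and u: "fractional_cover V K u" "cover_cost V \<epsilon> u \<le> cover_cost V \<epsilon> w"
    and v: "v \<in> V"
  shows "u v = w v"
proof -
  let ?d = "\<lambda>v. u v - w v"
  let ?m = "\<lambda>v. w v + 1 / 2 * ?d v"
  have "fractional_cover V K ?m"
    unfolding fractional_cover_def
  proof (intro conjI ballI)
    fix v assume "v \<in> V"
    then have "0 \<le> w v" "0 \<le> u v"
      using w u by (auto simp: fractional_cover_def optimal_cover_def)
    then show "0 \<le> ?m v" by (simp add: field_simps)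
  next
    fix e assume "e \<in> K"
    then have "1 \<le> sum w e" "1 \<le> sum u e"
      using w u by (auto simp: fractional_cover_def optimal_cover_def)
    moreover have "sum ?m e = (sum w e + sum u e) / 2"
      by (simp add: sum.distrib sum_subtractf sum_divide_distrib[symmetric] field_simps)
    ultimately show "1 \<le> sum ?m e" by simp
  qed
  then have "cover_cost V \<epsilon> w \<le> cover_cost V \<epsilon> ?m" using w by (simp add: optimal_cover_def)
  \<comment> \<open>With L and Q the linear and quadratic terms of the expansion, step 1 gives L + Q
    \<le> 0 and step 1/2 gives L + Q/2 \<ge> 0, hence Q \<le> 0.\<close>
  moreover have "cover_cost V \<epsilon> (\<lambda>v. w v + 1 * ?d v) = cover_cost V \<epsilon> u" by simp
  ultimately have "\<epsilon> * (\<Sum>v\<in>V. (?d v)\<^sup>2) \<le> 0"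
    using u(2) unfolding cover_cost_add by (simp add: field_simps)
  then have "(\<Sum>v\<in>V. (?d v)\<^sup>2) \<le> 0" using \<epsilon> by (simp add: mult_le_0_iff)
  then have "(\<Sum>v\<in>V. (?d v)\<^sup>2) = 0" by (simp add: antisym sum_nonneg)
  then show ?thesis using V v by (simp add: sum_nonneg_eq_0_iff)
qed

text \<open>Truncation at 1 keeps a cover a cover and does not raise its cost, so the search is
  confined to a compact cube. The bound by 1 later limits the dual degrees to
  \<open>1 + 2 * \<epsilon>\<close>.\<close>

lemma optimal_cover_exists:
  assumes V: "finite V" and \<epsilon>: "0 < \<epsilon>" and K: "\<And>e. e \<in> K \<Longrightarrow> e \<subseteq> V \<and> e \<noteq> {}"
  shows "\<exists>w. optimal_cover V K \<epsilon> w \<and> (\<forall>v\<in>V. w v \<le> 1)"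
proof -
  \<comment> \<open>Pinning the values outside \<open>V\<close> to 0 makes every factor compact, so
    Tychonoff's theorem applies.\<close>
  define B where "B = (\<lambda>v. if v \<in> V then {0..1::real} else {0})"
  define C where "C = PiE UNIV B \<inter> (\<Inter>e\<in>K. {w. 1 \<le> sum w e})"
  have "compact (PiE UNIV B)"
    using compactin_PiE[of "\<lambda>_. euclidean" UNIV B]
    by (simp add: euclidean_product_topology B_def)
  moreover have "closed {w::'a \<Rightarrow> real. 1 \<le> sum w e}" for e
    by (intro closed_Collect_le continuous_intros continuous_on_product_coordinates)
  ultimately have cC: "compact C"
    unfolding C_def by (intro compact_Int_closed closed_INT) auto
  have trunc: "(\<lambda>v. if v \<in> V then min 1 (u v) else 0) \<in> C" if u: "fractional_cover V K u" for u
  proof -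
    have "1 \<le> (\<Sum>v\<in>e. if v \<in> V then min 1 (u v) else 0)" if e: "e \<in> K" for e
    proof -
      have eV: "e \<subseteq> V" "finite e" using K[OF e] V finite_subset by auto
      then have eq: "(\<Sum>v\<in>e. if v \<in> V then min 1 (u v) else 0) = (\<Sum>v\<in>e. min 1 (u v))"
        by (intro sum.cong) auto
      have u0: "0 \<le> min 1 (u v)" if "v \<in> e" for v
        using u that eV by (auto simp: fractional_cover_def)
      \<comment> \<open>A vertex of weight at least 1 still covers \<open>e\<close> alone after
        truncation; without one, truncation changes nothing on \<open>e\<close>.\<close>
      show ?thesis
      proof (cases "\<exists>v\<in>e. 1 \<le> u v")
        case True
        then obtain v where v: "v \<in> e" "1 \<le> u v" by blast
        have "min 1 (u v) \<le> (\<Sum>v\<in>e. min 1 (u v))"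
          by (rule member_le_sum) (use v eV u0 in auto)
        then show ?thesis using v eq by simp
      next
        case False
        then have "(\<Sum>v\<in>e. min 1 (u v)) = sum u e" by (intro sum.cong) auto
        then show ?thesis using u e eq by (simp add: fractional_cover_def)
      qed
    qed
    then show ?thesis using u by (auto simp: C_def B_def fractional_cover_def)
  qed
  have "fractional_cover V K (\<lambda>_. 1)"
  proof -
    have "1 \<le> card e" if "e \<in> K" for e
      using K[OF that] V by (metis One_nat_def Suc_leI card_gt_0_iff finite_subset)
    then show ?thesis by (force simp: fractional_cover_def)
  qed
  from trunc[OF this] have "C \<noteq> {}" by blast
  moreover have "continuous_on C (cover_cost V \<epsilon>)"
    unfolding cover_cost_def
    by (intro continuous_intros continuous_on_subset[OF continuous_on_product_coordinates]) auto
  ultimately obtain w where w: "w \<in> C"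
      "\<And>u. u \<in> C \<Longrightarrow> cover_cost V \<epsilon> w \<le> cover_cost V \<epsilon> u"
    using continuous_attains_inf[OF cC] by metis
  have wB: "w v \<in> B v" for v using w(1) by (auto simp: C_def)
  have w01: "0 \<le> w v \<and> w v \<le> 1" if "v \<in> V" for v using wB[of v] that by (simp add: B_def)
  have "cover_cost V \<epsilon> w \<le> cover_cost V \<epsilon> u" if u: "fractional_cover V K u" for u
  proof -
    let ?t = "\<lambda>v. if v \<in> V then min 1 (u v) else 0"
    have "cover_cost V \<epsilon> ?t \<le> cover_cost V \<epsilon> u"
      unfolding cover_cost_def
    proof (rule sum_mono)
      fix v assume "v \<in> V"
      then have "0 \<le> u v" using u by (simp add: fractional_cover_def)
      then show "?t v + \<epsilon> * (?t v)\<^sup>2 \<le> u v + \<epsilon> * (u v)\<^sup>2"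
        using \<epsilon> \<open>v \<in> V\<close> by (auto intro!: add_mono mult_left_mono power_mono simp: min_def)
    qed
    then show ?thesis using w(2)[OF trunc[OF u]] by simp
  qed
  then show ?thesis using w01 w(1)
    by (intro exI[of _ w]) (auto simp: optimal_cover_def fractional_cover_def C_def)
qed

section \<open>First-order optimality and multipliers\<close>

lemma sum_edge:
  fixes w :: "'a \<Rightarrow> real"
  assumes "finite V" "e \<subseteq> V"
  shows "(\<Sum>v\<in>V. of_bool (v \<in> e) * w v) = sum w e"
  using assms by (simp add: of_bool_def if_distrib[of "\<lambda>c. c * _"] sum.If_cases Int_absorb1 cong: if_cong)

text \<open>The constraints that are not tight have slack and are finitely many, so a small step
  along \<open>d\<close> stays feasible; a negative derivative would then contradict
  optimality.\<close>

lemma optimal_cover_direction: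
  assumes V: "finite V" and K: "finite K" "\<And>e. e \<in> K \<Longrightarrow> e \<subseteq> V"
    and w: "optimal_cover V K \<epsilon> w"
    and dV: "\<And>v. v \<in> V \<Longrightarrow> w v = 0 \<Longrightarrow> 0 \<le> d v"
    and dK: "\<And>e. e \<in> K \<Longrightarrow> sum w e = 1 \<Longrightarrow> 0 \<le> sum d e"
  shows "0 \<le> (\<Sum>v\<in>V. (1 + 2 * \<epsilon> * w v) * d v)"
proof (rule ccontr)
  assume "\<not> ?thesis"
  then have neg: "(\<Sum>v\<in>V. (1 + 2 * \<epsilon> * w v) * d v) < 0" by simp
  have w0: "\<And>v. v \<in> V \<Longrightarrow> 0 \<le> w v" and w1: "\<And>e. e \<in> K \<Longrightarrow> 1 \<le> sum w e"
    using w by (auto simp: optimal_cover_def fractional_cover_def)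
  have pos: "\<forall>\<^sub>F t in at_right 0. 0 \<le> b + t * c" if "0 \<le> b" "b = 0 \<Longrightarrow> 0 \<le> c" for b c :: real
  proof (cases "b = 0")
    case True
    then show ?thesis using that by (auto intro!: eventually_at_rightI[of 0 1])
  next
    case False
    have "((\<lambda>t. b + t * c) \<longlongrightarrow> b + 0 * c) (at_right 0)" by (intro tendsto_intros)
    then have "\<forall>\<^sub>F t in at_right 0. 0 < b + t * c"
      using False that by (intro order_tendstoD(1)[of _ "b + 0 * c"]) auto
    then show ?thesis by eventually_elim simp
  qed
  have "\<forall>\<^sub>F t in at_right 0. \<forall>v\<in>V. 0 \<le> w v + t * d v"
    using V w0 dV by (intro eventually_ball_finite ballI pos) auto
  moreover have "\<forall>\<^sub>F t in at_right 0. \<forall>e\<in>K. 0 \<le> sum w e - 1 + t * sum d e"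
    using K w1 dK by (intro eventually_ball_finite ballI pos) auto
  moreover have "\<forall>\<^sub>F t in at_right 0.
      (\<Sum>v\<in>V. (1 + 2 * \<epsilon> * w v) * d v) + t * (\<epsilon> * (\<Sum>v\<in>V. (d v)\<^sup>2)) < 0"
  proof -
    have "((\<lambda>t. (\<Sum>v\<in>V. (1 + 2 * \<epsilon> * w v) * d v) + t * (\<epsilon> * (\<Sum>v\<in>V. (d v)\<^sup>2))) \<longlongrightarrow>
        (\<Sum>v\<in>V. (1 + 2 * \<epsilon> * w v) * d v) + 0 * (\<epsilon> * (\<Sum>v\<in>V. (d v)\<^sup>2))) (at_right 0)"
      by (intro tendsto_intros)
    then show ?thesis by (rule order_tendstoD(2)) (use neg in simp)
  qed
  moreover have "\<forall>\<^sub>F t::real in at_right 0. 0 < t" by (auto intro!: eventually_at_rightI[of 0 1])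
  ultimately have "\<forall>\<^sub>F t in at_right 0. 0 < t \<and> (\<forall>v\<in>V. 0 \<le> w v + t * d v) \<and>
      (\<forall>e\<in>K. 0 \<le> sum w e - 1 + t * sum d e) \<and>
      (\<Sum>v\<in>V. (1 + 2 * \<epsilon> * w v) * d v) + t * (\<epsilon> * (\<Sum>v\<in>V. (d v)\<^sup>2)) < 0"
    by eventually_elim blast
  then obtain t where t: "0 < t" "\<forall>v\<in>V. 0 \<le> w v + t * d v"
      "\<forall>e\<in>K. 0 \<le> sum w e - 1 + t * sum d e"
      "(\<Sum>v\<in>V. (1 + 2 * \<epsilon> * w v) * d v) + t * (\<epsilon> * (\<Sum>v\<in>V. (d v)\<^sup>2)) < 0"
    using eventually_happens'[OF trivial_limit_at_right_real] by blast
  have "fractional_cover V K (\<lambda>v. w v + t * d v)"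
    using t(2,3) by (auto simp: fractional_cover_def sum.distrib sum_distrib_left[symmetric])
  then have "cover_cost V \<epsilon> w \<le> cover_cost V \<epsilon> (\<lambda>v. w v + t * d v)"
    using w by (simp add: optimal_cover_def)
  then show False unfolding cover_cost_add using t(1,4) by (simp add: zero_le_mult_iff)
qed

text \<open>
  Karush-Kuhn-Tucker multipliers: \<open>1 + 2 * \<epsilon> * w v\<close> is the partial derivative of the cost at \<open>v\<close>.
  The bound on the support is Caratheodory's, with the slacks of the vertex constraints counted
  as generators.
\<close>

lemma optimal_cover_dual:
  assumes V: "finite V" and K: "finite K" "\<And>e. e \<in> K \<Longrightarrow> e \<subseteq> V"
    and w: "optimal_cover V K \<epsilon> w"
  obtains f where
    "\<And>e. e \<in> K \<Longrightarrow> 0 \<le> f e"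
    "\<And>e. e \<in> K \<Longrightarrow> f e \<noteq> 0 \<Longrightarrow> sum w e = 1"
    "\<And>v. v \<in> V \<Longrightarrow> (\<Sum>e\<in>{e \<in> K. v \<in> e}. f e) \<le> 1 + 2 * \<epsilon> * w v"
    "\<And>v. v \<in> V \<Longrightarrow> w v \<noteq> 0 \<Longrightarrow> (\<Sum>e\<in>{e \<in> K. v \<in> e}. f e) = 1 + 2 * \<epsilon> * w v"
    "card {e \<in> K. f e \<noteq> 0} \<le> card {v \<in> V. (\<Sum>e\<in>{e \<in> K. v \<in> e}. f e) = 1 + 2 * \<epsilon> * w v}"
proof -
  define T where "T = {e \<in> K. sum w e = 1}"
  define Z where "Z = {v \<in> V. w v = 0}"
  \<comment> \<open>Normals of the tight constraints: indicators of tight edges for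
    \<open>Inl\<close>, unit vectors of vertices of weight 0 for \<open>Inr\<close>.\<close>
  define a where "a i v = (of_bool (case i of Inl e \<Rightarrow> v \<in> e | Inr z \<Rightarrow> v \<in> {z}) :: real)"
    for i :: "'a set + 'a" and v
  have fin: "finite T" "finite Z" using V K by (auto simp: T_def Z_def)
  then have finTZ: "finite (T <+> Z)" by simp
  have "0 \<le> (\<Sum>v\<in>V. (1 + 2 * \<epsilon> * w v) * x v)"
    if x: "\<And>i. i \<in> T <+> Z \<Longrightarrow> 0 \<le> (\<Sum>v\<in>V. a i v * x v)" for x
  proof (rule optimal_cover_direction[OF V K w])
    fix v assume "v \<in> V" "w v = 0"
    then have "0 \<le> (\<Sum>u\<in>V. a (Inr v) u * x u)" by (intro x) (auto simp: Z_def)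
    then show "0 \<le> x v"
      using sum_edge[OF V, of "{v}" x] \<open>v \<in> V\<close> by (simp add: a_def)
  next
    fix e assume e: "e \<in> K" "sum w e = 1"
    then have "0 \<le> (\<Sum>u\<in>V. a (Inl e) u * x u)" by (intro x) (auto simp: T_def)
    then show "0 \<le> sum x e" by (simp add: a_def sum_edge[OF V K(2)[OF e(1)]])
  qed
  from farkas[OF V finTZ this] obtain l where l: "\<forall>i\<in>T <+> Z. 0 \<le> l i"
    "\<forall>v\<in>V. 1 + 2 * \<epsilon> * w v = (\<Sum>i\<in>T <+> Z. l i * a i v)" by blast
  from conic_caratheodory[OF V finTZ, of l a] l obtain k where k: "\<forall>i\<in>T <+> Z. 0 \<le> k i"
    "\<forall>v\<in>V. (\<Sum>i\<in>T <+> Z. k i * a i v) = 1 + 2 * \<epsilon> * w v"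
    "card {i\<in>T <+> Z. k i \<noteq> 0} \<le> card V" by auto
  define f where "f e = (if e \<in> T then k (Inl e) else 0)" for e
  define s where "s v = (if v \<in> Z then k (Inr v) else 0)" for v
  \<comment> \<open>\<open>s v\<close> is the multiplier of \<open>0 \<le> w v\<close>. It vanishes
    where \<open>w v\<close> is nonzero, which is complementary slackness.\<close>
  have slack: "(\<Sum>e\<in>{e \<in> K. v \<in> e}. f e) + s v = 1 + 2 * \<epsilon> * w v" if v: "v \<in> V" for v
  proof -
    have "(\<Sum>e\<in>{e \<in> K. v \<in> e}. f e) = (\<Sum>e\<in>{e \<in> T. v \<in> e}. k (Inl e))"
      by (rule sum.mono_neutral_cong_right) (use K in \<open>auto simp: f_def T_def\<close>)
    also have "\<dots> = (\<Sum>e\<in>T. k (Inl e) * a (Inl e) v)"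
      by (rule sum.mono_neutral_cong_left) (use fin in \<open>auto simp: a_def\<close>)
    finally have 1: "(\<Sum>e\<in>{e \<in> K. v \<in> e}. f e) = (\<Sum>e\<in>T. k (Inl e) * a (Inl e) v)" .
    have "(\<Sum>z\<in>Z. k (Inr z) * a (Inr z) v) = (\<Sum>z\<in>Z. if z = v then k (Inr v) else 0)"
      by (rule sum.cong) (auto simp: a_def)
    then have 2: "s v = (\<Sum>z\<in>Z. k (Inr z) * a (Inr z) v)" using fin by (simp add: s_def)
    show ?thesis unfolding 1 2 using k(2) v fin by (simp add: sum.Plus)
  qed
  have f0: "0 \<le> f e" for e using k(1) by (auto simp: f_def)
  have s0: "0 \<le> s v" for v using k(1) by (auto simp: s_def)
  \<comment> \<open>The bound \<open>card V\<close> counts edges and vertices with slack together;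
    removing the latter leaves the number of tight vertices.\<close>
  have "{i\<in>T <+> Z. k i \<noteq> 0} = {e \<in> K. f e \<noteq> 0} <+> {v \<in> V. s v \<noteq> 0}"
    by (auto simp: f_def s_def T_def Z_def split: if_splits)
  then have "card {e \<in> K. f e \<noteq> 0} + card {v \<in> V. s v \<noteq> 0} \<le> card V"
    using k(3) V K by (simp add: card_Plus)
  moreover have "card {v \<in> V. s v \<noteq> 0} + card {v \<in> V. s v = 0} = card V"
    using V by (subst card_Un_disjoint[symmetric]) (auto intro!: arg_cong[of _ _ card])
  moreover have "{v \<in> V. s v = 0} = {v \<in> V. (\<Sum>e\<in>{e \<in> K. v \<in> e}. f e) = 1 + 2 * \<epsilon> * w v}"
    using slack by force
  ultimately have support: "card {e \<in> K. f e \<noteq> 0}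
      \<le> card {v \<in> V. (\<Sum>e\<in>{e \<in> K. v \<in> e}. f e) = 1 + 2 * \<epsilon> * w v}" by simp
  show ?thesis
  proof (rule that[OF _ _ _ _ support])
    show "0 \<le> f e" for e by (rule f0)
    show "sum w e = 1" if "f e \<noteq> 0" for e
      using that by (auto simp: f_def T_def split: if_splits)
    show "(\<Sum>e\<in>{e \<in> K. v \<in> e}. f e) \<le> 1 + 2 * \<epsilon> * w v" if "v \<in> V" for v
      using slack[OF that] s0[of v] by linarith
    show "(\<Sum>e\<in>{e \<in> K. v \<in> e}. f e) = 1 + 2 * \<epsilon> * w v" if "v \<in> V" "w v \<noteq> 0" for v
      using slack[OF that(1)] that(2) by (simp add: s_def Z_def)
  qed
qed

section \<open>Dual weights, small subfamilies and weak duality\<close>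

text \<open>Double counting of incidences: a cover as \<open>u\<close> compares covers with
  matchings, and the constant 1 compares degrees with edge sizes.\<close>

lemma sum_vertex_degrees:
  fixes f :: "'a set \<Rightarrow> real"
  assumes V: "finite V" and K: "finite K" "\<And>e. e \<in> K \<Longrightarrow> e \<subseteq> V"
  shows "(\<Sum>v\<in>V. u v * (\<Sum>e\<in>{e \<in> K. v \<in> e}. f e)) = (\<Sum>e\<in>K. f e * sum u e)"
proof -
  have "(\<Sum>v\<in>V. u v * (\<Sum>e\<in>{e \<in> K. v \<in> e}. f e)) = (\<Sum>v\<in>V. \<Sum>e\<in>{e \<in> K. v \<in> e}. u v * f e)"
    by (simp add: sum_distrib_left)
  also have "\<dots> = (\<Sum>e\<in>K. \<Sum>v\<in>{v \<in> V. v \<in> e}. u v * f e)"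
    using V K(1) by (rule sum.swap_restrict)
  also have "\<dots> = (\<Sum>e\<in>K. f e * sum u e)"
  proof (rule sum.cong)
    fix e assume "e \<in> K"
    then have "{v \<in> V. v \<in> e} = e" using K by auto
    then show "(\<Sum>v\<in>{v \<in> V. v \<in> e}. u v * f e) = f e * sum u e"
      by (simp add: sum_distrib_left mult.commute)
  qed simp
  finally show ?thesis .
qed

text \<open>The multipliers certify optimality of \<open>w\<close> already on their support
  \<open>F\<close>. Each vertex in the support bound has degree at least 1, while all degrees add up
  to \<open>r\<close> times the total of the multipliers.\<close>

lemma optimal_cover_small_subfamily:
  assumes H: "uniform_hypergraph r V K" and \<epsilon>: "0 < \<epsilon>"
    and w: "optimal_cover V K \<epsilon> w" "\<And>v. v \<in> V \<Longrightarrow> w v \<le> 1"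
    and size: "\<And>f. fractional_matching V K f \<Longrightarrow> (1 + 2 * \<epsilon>) * fractional_size K f < s"
    and s: "0 < r" "real r * s \<le> real m"
  shows "sum w V < s"
    and "\<exists>F\<subseteq>K. card F < m \<and> optimal_cover V F \<epsilon> w"
proof -
  have V: "finite V" and K2: "\<And>e. e \<in> K \<Longrightarrow> e \<subseteq> V" and cK: "\<And>e. e \<in> K \<Longrightarrow> card e = r"
    using H by (auto simp: uniform_hypergraph_def)
  have K: "finite K" by (rule finite_subset[of _ "Pow V"]) (use K2 V in auto)
  obtain f where f0: "\<And>e. e \<in> K \<Longrightarrow> 0 \<le> f e"
    and tight: "\<And>e. e \<in> K \<Longrightarrow> f e \<noteq> 0 \<Longrightarrow> sum w e = 1"
    and deg_le: "\<And>v. v \<in> V \<Longrightarrow> (\<Sum>e\<in>{e \<in> K. v \<in> e}. f e) \<le> 1 + 2 * \<epsilon> * w v"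
    and deg_eq: "\<And>v. v \<in> V \<Longrightarrow> w v \<noteq> 0 \<Longrightarrow> (\<Sum>e\<in>{e \<in> K. v \<in> e}. f e) = 1 + 2 * \<epsilon> * w v"
    and card_le: "card {e \<in> K. f e \<noteq> 0}
      \<le> card {v \<in> V. (\<Sum>e\<in>{e \<in> K. v \<in> e}. f e) = 1 + 2 * \<epsilon> * w v}"
    using optimal_cover_dual[OF V K K2 w(1)] by blast
  have wc: "fractional_cover V K w" using w by (simp add: optimal_cover_def)
  then have w0: "\<And>v. v \<in> V \<Longrightarrow> 0 \<le> w v" by (simp add: fractional_cover_def)
  define D where "D v = (\<Sum>e\<in>{e \<in> K. v \<in> e}. f e)" for v
  have D0: "0 \<le> D v" for v unfolding D_def by (rule sum_nonneg) (use f0 in auto)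
  have swap: "(\<Sum>v\<in>V. u v * D v) = (\<Sum>e\<in>K. f e * sum u e)" for u
    unfolding D_def by (rule sum_vertex_degrees[OF V K K2])
  \<comment> \<open>Since \<open>w\<close> is at most 1 on \<open>V\<close>, dividing the
    multipliers by \<open>1 + 2 * \<epsilon>\<close> gives a matching, to which \<open>size\<close>
    applies.\<close>
  have "fractional_matching V K (\<lambda>e. f e / (1 + 2 * \<epsilon>))"
    unfolding fractional_matching_def
  proof (intro conjI ballI)
    fix v assume v: "v \<in> V"
    have "D v \<le> 1 + 2 * \<epsilon> * w v" using deg_le[OF v] by (simp add: D_def)
    also have "\<dots> \<le> 1 + 2 * \<epsilon>" using w(2)[OF v] \<epsilon> by simp
    finally show "(\<Sum>e\<in>{e \<in> K. v \<in> e}. f e / (1 + 2 * \<epsilon>)) \<le> 1"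
      using \<epsilon> by (simp add: sum_divide_distrib[symmetric] D_def)
  qed (use f0 \<epsilon> in auto)
  from size[OF this] have fs: "sum f K < s"
    using \<epsilon> by (simp add: fractional_size_def sum_divide_distrib[symmetric])
  \<comment> \<open>By complementary slackness the gradient at \<open>w\<close>, paired with
    \<open>w\<close>, is exactly the total of the multipliers.\<close>
  have complementary: "(\<Sum>v\<in>V. (1 + 2 * \<epsilon> * w v) * w v) = sum f K"
  proof -
    have "(\<Sum>v\<in>V. (1 + 2 * \<epsilon> * w v) * w v) = (\<Sum>v\<in>V. w v * D v)"
      by (rule sum.cong) (use deg_eq in \<open>force simp: D_def\<close>)+
    also have "\<dots> = sum f K" unfolding swap by (rule sum.cong) (use tight in force)+
    finally show ?thesis .
  qed
  have "sum w V \<le> (\<Sum>v\<in>V. (1 + 2 * \<epsilon> * w v) * w v)"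
    by (rule sum_mono) (use w0 \<epsilon> in \<open>auto simp: distrib_right\<close>)
  then show "sum w V < s" using complementary fs by simp
  define F where "F = {e \<in> K. f e \<noteq> 0}"
  have "real (card F) \<le> real (card {v \<in> V. D v = 1 + 2 * \<epsilon> * w v})"
    using card_le by (simp add: F_def D_def)
  also have "\<dots> = (\<Sum>v\<in>{v \<in> V. D v = 1 + 2 * \<epsilon> * w v}. 1)" by simp
  also have "\<dots> \<le> (\<Sum>v\<in>{v \<in> V. D v = 1 + 2 * \<epsilon> * w v}. D v)"
    by (rule sum_mono) (use w0 \<epsilon> in auto)
  also have "\<dots> \<le> (\<Sum>v\<in>V. D v)" by (rule sum_mono2) (use V D0 in auto)
  also have "\<dots> = (\<Sum>e\<in>K. f e * real r)" using swap[of "\<lambda>_. 1"] cK by simp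
  also have "\<dots> = real r * sum f K" by (simp add: sum_distrib_left mult.commute)
  also have "\<dots> < real r * s" using fs s by simp
  finally have "card F < m" using s by linarith
  \<comment> \<open>Weak duality: the gradient at \<open>w\<close> paired with a cover
    \<open>u\<close> of \<open>F\<close> is at least \<open>sum f K\<close>, its pairing with
    \<open>w\<close>. Convexity turns this into a comparison of costs.\<close>
  moreover have "cover_cost V \<epsilon> w \<le> cover_cost V \<epsilon> u" if u: "fractional_cover V F u" for u
  proof -
    have "sum f K \<le> (\<Sum>e\<in>K. f e * sum u e)"
    proof (rule sum_mono)
      fix e assume e: "e \<in> K"
      show "f e \<le> f e * sum u e"
      proof (cases "e \<in> F")
        case True
        then have "1 \<le> sum u e" using u by (simp add: fractional_cover_def)
        then show ?thesis using f0[OF e] by (simp add: mult_le_cancel_left1)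
      qed (use e in \<open>simp add: F_def\<close>)
    qed
    also have "\<dots> = (\<Sum>v\<in>V. u v * D v)" by (simp add: swap)
    also have "\<dots> \<le> (\<Sum>v\<in>V. (1 + 2 * \<epsilon> * w v) * u v)"
    proof (rule sum_mono)
      fix v assume v: "v \<in> V"
      then show "u v * D v \<le> (1 + 2 * \<epsilon> * w v) * u v"
        using mult_left_mono[OF deg_le[OF v], of "u v"] u
        by (simp add: fractional_cover_def D_def mult.commute)
    qed
    finally have "0 \<le> (\<Sum>v\<in>V. (1 + 2 * \<epsilon> * w v) * (u v - w v))"
      using complementary by (simp add: right_diff_distrib sum_subtractf)
    then show ?thesis using cover_cost_tangent[of \<epsilon> V w u] \<epsilon> by simp
  qed
  moreover have "F \<subseteq> K" by (auto simp: F_def)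
  ultimately show "\<exists>F\<subseteq>K. card F < m \<and> optimal_cover V F \<epsilon> w"
    using fractional_cover_antimono[OF wc] by (auto simp: optimal_cover_def)
qed

lemma fractional_matching_size_le_cover:
  assumes V: "finite V" and K: "finite K" "\<And>e. e \<in> K \<Longrightarrow> e \<subseteq> V"
    and w: "fractional_cover V K w" and f: "fractional_matching V K f"
  shows "fractional_size K f \<le> sum w V"
proof -
  have "fractional_size K f \<le> (\<Sum>e\<in>K. f e * sum w e)"
    unfolding fractional_size_def
    by (rule sum_mono) (use w f in \<open>auto simp: fractional_cover_def fractional_matching_def
        mult_le_cancel_left1\<close>)
  also have "\<dots> = (\<Sum>v\<in>V. w v * (\<Sum>e\<in>{e \<in> K. v \<in> e}. f e))"
    by (rule sum_vertex_degrees[OF V K, symmetric])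
  also have "\<dots> \<le> (\<Sum>v\<in>V. w v * 1)"
    by (intro sum_mono mult_left_mono)
      (use w f in \<open>auto simp: fractional_cover_def fractional_matching_def\<close>)
  finally show ?thesis by simp
qed

section \<open>The extremal rainbow selection\<close>

text \<open>A size of at least \<open>s\<close> is enough here, since a matching can be scaled down
  to the exact size.\<close>

lemma rainbow_selection:
  fixes s :: real
  assumes H: "uniform_hypergraph r V H" and r: "0 < r" and s: "0 < s" "real r * s \<le> real m"
    and EH: "\<And>i. i \<in> {1..m} \<Longrightarrow> E i \<subseteq> H"
    and E: "\<And>i. i \<in> {1..m} \<Longrightarrow> s \<le> fractional_matching_number V (E i)"
  shows "\<exists>x f. (\<forall>i\<in>{1..m}. x i \<in> E i) \<and> fractional_matching V (x ` {1..m}) f \<and>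
           s \<le> fractional_size (x ` {1..m}) f"
proof (rule ccontr)
  assume contr: "\<not> ?thesis"
  have sub: "uniform_hypergraph r V K" if "K \<subseteq> H" for K
    using H that by (auto simp: uniform_hypergraph_def)
  have V: "finite V" and eV: "\<And>e. e \<in> H \<Longrightarrow> e \<subseteq> V \<and> e \<noteq> {}"
    using H r by (auto simp: uniform_hypergraph_def)
  have fH: "finite H" by (rule finite_subset[of _ "Pow V"]) (use eV V in auto)
  have large: "\<exists>f. fractional_matching V (E i) f \<and> s \<le> fractional_size (E i) f"
    if "i \<in> {1..m}" for i
    using fractional_matching_number_attained[OF sub[OF EH] r, OF that] E[OF that] by metis
  have nonempty: "E i \<noteq> {}" if "i \<in> {1..m}" for i
    using large[OF that] s by (auto simp: fractional_size_def)
  define X where "X = PiE {1..m} E"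
  have finX: "finite X" unfolding X_def
    by (intro finite_PiE) (auto intro: finite_subset[OF EH fH])
  have "X \<noteq> {}" unfolding X_def PiE_eq_empty_iff using nonempty by blast
  have XE: "x i \<in> E i" if "x \<in> X" "i \<in> {1..m}" for x i
    using that unfolding X_def by (rule PiE_mem)
  have XH: "x ` {1..m} \<subseteq> H" if "x \<in> X" for x using XE[OF that] EH by blast
  have m: "{1..m} \<noteq> {}"
  proof -
    have "0 < real r * s" using r s by simp
    then have "0 < real m" using s by linarith
    then show ?thesis by simp
  qed
  define N where "N x = fractional_matching_number V (x ` {1..m})" for x
  have N: "N x < s" if "x \<in> X" for x
  proof -
    from fractional_matching_number_attained[OF sub[OF XH[OF that]] r]
    obtain f where "fractional_matching V (x ` {1..m}) f" "fractional_size (x ` {1..m}) f = N x"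
      unfolding N_def by blast
    moreover have "\<forall>i\<in>{1..m}. x i \<in> E i" using XE[OF that] by blast
    ultimately have "\<not> s \<le> N x" using contr by metis
    then show ?thesis by simp
  qed
  have size_le: "fractional_size (x ` {1..m}) f \<le> N x"
    if "x \<in> X" "fractional_matching V (x ` {1..m}) f" for x f
    using fractional_matching_number_attained[OF sub[OF XH[OF that(1)]] r] that(2)
    unfolding N_def by metis
  \<comment> \<open>There are finitely many selections, each with a strict gap below
    \<open>s\<close>, so one \<epsilon> serves them all.\<close>
  have "\<forall>\<^sub>F \<epsilon> in at_right 0. \<forall>x\<in>X. (1 + 2 * \<epsilon>) * N x < s"
  proof (intro eventually_ball_finite finX ballI)
    fix x assume "x \<in> X"
    have "((\<lambda>\<epsilon>. (1 + 2 * \<epsilon>) * N x) \<longlongrightarrow> (1 + 2 * 0) * N x) (at_right 0)"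
      by (intro tendsto_intros)
    then show "\<forall>\<^sub>F \<epsilon> in at_right 0. (1 + 2 * \<epsilon>) * N x < s"
      by (rule order_tendstoD(2)) (use N[OF \<open>x \<in> X\<close>] in simp)
  qed
  moreover have "\<forall>\<^sub>F \<epsilon>::real in at_right 0. 0 < \<epsilon>" by (auto intro!: eventually_at_rightI[of 0 1])
  ultimately have "\<forall>\<^sub>F \<epsilon> in at_right 0. 0 < \<epsilon> \<and> (\<forall>x\<in>X. (1 + 2 * \<epsilon>) * N x < s)"
    by eventually_elim blast
  then obtain \<epsilon> :: real where \<epsilon>: "0 < \<epsilon>" and gap: "\<And>x. x \<in> X \<Longrightarrow> (1 + 2 * \<epsilon>) * N x < s"
    using eventually_happens'[OF trivial_limit_at_right_real] by blast
  \<comment> \<open>A rainbow selection of \<open>m - 1\<close> edges is encoded as a full selection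
    with an omitted index.\<close>
  define u where "u p = (SOME w. optimal_cover V (fst p ` ({1..m} - {snd p})) \<epsilon> w)" for p
  have u: "optimal_cover V (x ` ({1..m} - {i})) \<epsilon> (u (x, i))" if "x \<in> X" for x i
  proof -
    have "\<exists>w. optimal_cover V (x ` ({1..m} - {i})) \<epsilon> w"
    proof -
      have "e \<subseteq> V \<and> e \<noteq> {}" if "e \<in> x ` ({1..m} - {i})" for e
        using that XH[OF \<open>x \<in> X\<close>] eV by blast
      from optimal_cover_exists[OF V \<epsilon> this] show ?thesis by blast
    qed
    from someI_ex[OF this] show ?thesis by (simp add: u_def)
  qed
  let ?C = "(\<lambda>p. cover_cost V \<epsilon> (u p)) ` (X \<times> {1..m})"
  have C: "finite ?C" "?C \<noteq> {}" using finX \<open>X \<noteq> {}\<close> m by auto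
  from Max_in[OF C] obtain x i where xi: "x \<in> X" "i \<in> {1..m}"
    "cover_cost V \<epsilon> (u (x, i)) = Max ?C" by force
  have max: "cover_cost V \<epsilon> (u (y, j)) \<le> cover_cost V \<epsilon> (u (x, i))"
    if "y \<in> X" "j \<in> {1..m}" for y j
    unfolding xi(3) by (rule Max_ge[OF C(1)]) (use that in auto)
  define W where "W = u (x, i)"
  have step: "1 \<le> sum W e \<and> sum W V < s" if e: "e \<in> E i" for e
  proof -
    \<comment> \<open>Filling the omitted index \<open>i\<close> with \<open>e\<close> keeps the
      other edges of \<open>x\<close>, so covers of \<open>y\<close> also cover those.\<close>
    define y where "y = x(i := e)"
    have y: "y \<in> X" using e xi unfolding X_def y_def by (auto simp: PiE_iff extensional_def)
    define K where "K = y ` {1..m}"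
    have K: "K \<subseteq> H" using XH[OF y] by (simp add: K_def)
    have "e' \<subseteq> V \<and> e' \<noteq> {}" if "e' \<in> K" for e' using that K eV by blast
    from optimal_cover_exists[OF V \<epsilon> this]
    obtain w where w: "optimal_cover V K \<epsilon> w" "\<And>v. v \<in> V \<Longrightarrow> w v \<le> 1" by blast
    have size: "(1 + 2 * \<epsilon>) * fractional_size K f < s" if "fractional_matching V K f" for f
    proof -
      have "(1 + 2 * \<epsilon>) * fractional_size K f \<le> (1 + 2 * \<epsilon>) * N y"
        using size_le[OF y] that \<epsilon> by (simp add: K_def mult_left_mono)
      then show ?thesis using gap[OF y] by simp
    qed
    note small = optimal_cover_small_subfamily[OF sub[OF K] \<epsilon> w size r s(2)]
    from small(2) obtain F where F: "F \<subseteq> K" "card F < m" "optimal_cover V F \<epsilon> w" by blast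
    \<comment> \<open>Edges of \<open>y\<close> may coincide, so one index per edge of
      \<open>F\<close> is chosen. Fewer than \<open>m\<close> are used, and some \<open>j\<close> is
      free.\<close>
    from F(1)[unfolded K_def subset_image_inj]
    obtain U where U: "U \<subseteq> {1..m}" "inj_on y U" "F = y ` U" by blast
    have "card U < card {1..m}" using F(2) U by (simp add: card_image)
    then have "U \<noteq> {1..m}" by auto
    then obtain j where j: "j \<in> {1..m}" "j \<notin> U" using U(1) by blast
    \<comment> \<open>\<open>F\<close> lies in \<open>y\<close> without \<open>j\<close>, so the
      minimum over \<open>F\<close> is at most the one for \<open>(y, j)\<close>, which maximality
      bounds by the cost of \<open>W\<close>.\<close>
    have "fractional_cover V F (u (y, j))"
      by (rule fractional_cover_antimono[of _ "y ` ({1..m} - {j})"])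
        (use u[OF y, of j] U j in \<open>auto simp: optimal_cover_def\<close>)
    then have "cover_cost V \<epsilon> w \<le> cover_cost V \<epsilon> (u (y, j))"
      using F(3) by (simp add: optimal_cover_def)
    also have "\<dots> \<le> cover_cost V \<epsilon> W" unfolding W_def by (rule max[OF y j(1)])
    finally have le: "cover_cost V \<epsilon> w \<le> cover_cost V \<epsilon> W" .
    have cov: "fractional_cover V K w" using w by (simp add: optimal_cover_def)
    have "x ` ({1..m} - {i}) \<subseteq> K" unfolding K_def y_def by auto
    from fractional_cover_antimono[OF cov this]
    have covx: "fractional_cover V (x ` ({1..m} - {i})) w" .
    have xV: "e' \<subseteq> V" if "e' \<in> x ` ({1..m} - {i})" for e'
      using that XH[OF xi(1)] eV by blast
    \<comment> \<open>\<open>w\<close> also covers what \<open>W\<close> was optimal for and costs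
      no more, so the two agree on \<open>V\<close>.\<close>
    have eq: "w v = W v" if "v \<in> V" for v
      unfolding W_def
      by (rule optimal_cover_unique[OF V \<epsilon> _ u[OF xi(1)] covx le[unfolded W_def] that])
        (rule xV)
    have "e \<in> K" using xi(2) by (force simp: K_def y_def)
    then have "1 \<le> sum w e" "e \<subseteq> V" using cov K eV by (auto simp: fractional_cover_def)
    moreover have "sum w A = sum W A" if "A \<subseteq> V" for A by (rule sum.cong) (use that eq in auto)
    ultimately show ?thesis using small(1) by simp
  qed
  have W: "fractional_cover V (E i) W"
    using u[OF xi(1), of i] step by (auto simp: W_def optimal_cover_def fractional_cover_def)
  obtain f where f: "fractional_matching V (E i) f" "s \<le> fractional_size (E i) f"
    using large[OF xi(2)] by blast
  have "finite (E i)" using EH[OF xi(2)] fH by (rule finite_subset)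
  moreover have "e \<subseteq> V" if "e \<in> E i" for e using that EH[OF xi(2)] eV by blast
  ultimately have "fractional_size (E i) f \<le> sum W V"
    by (rule fractional_matching_size_le_cover[OF V _ _ W f(1)])
  then have "s \<le> sum W V" using f(2) by simp
  moreover obtain e where "e \<in> E i" using nonempty[OF xi(2)] by blast
  ultimately show False using step[of e] by linarith
qed

theorem theorem6:
  fixes r :: nat and n :: rat
    and V :: "'a set" and H :: "'a set set" and E :: "nat \<Rightarrow> 'a set set"
  assumes "r \<ge> 2" and "n > 0"
    and "uniform_hypergraph r V H"
    and "\<And>i. i \<in> {1..nat \<lceil>of_nat r * n\<rceil>} \<Longrightarrow> E i \<subseteq> H"
    and "\<And>i. i \<in> {1..nat \<lceil>of_nat r * n\<rceil>} \<Longrightarrow>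
           fractional_matching_number V (E i) \<ge> of_rat n"
  shows "has_rainbow_fractional_matching V (nat \<lceil>of_nat r * n\<rceil>) E (of_rat n)"
proof -
  define m where "m = nat \<lceil>of_nat r * n\<rceil>"
  have "of_nat r * n \<le> of_nat m" unfolding m_def by (rule of_nat_ceiling)
  then have "(of_rat (of_nat r * n) :: real) \<le> of_rat (of_nat m)" by (simp only: of_rat_less_eq)
  then have m: "real r * of_rat n \<le> real m" by (simp add: of_rat_mult)
  have n: "(0::real) < of_rat n" using assms(2) by simp
  obtain x f where x: "\<forall>i\<in>{1..m}. x i \<in> E i"
    and f: "fractional_matching V (x ` {1..m}) f" "of_rat n \<le> fractional_size (x ` {1..m}) f"
    using rainbow_selection[OF assms(3) _ n m, of E] assms unfolding m_def by auto
  \<comment> \<open>Scaling by \<open>t\<close>, at most 1, brings the size down to exactly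
    \<open>n\<close>.\<close>
  define t where "t = of_rat n / fractional_size (x ` {1..m}) f"
  have pos: "0 < fractional_size (x ` {1..m}) f" using n f(2) by linarith
  then have t: "0 \<le> t" "t \<le> 1" using assms(2) f(2) by (simp_all add: t_def)
  have "fractional_matching V (x ` {1..m}) (\<lambda>e. t * f e)"
    using f(1) t unfolding fractional_matching_def sum_distrib_left[symmetric]
    by (auto intro!: mult_le_one sum_nonneg)
  moreover have "fractional_size (x ` {1..m}) (\<lambda>e. t * f e) = t * fractional_size (x ` {1..m}) f"
    by (simp add: fractional_size_def sum_distrib_left)
  then have "fractional_size (x ` {1..m}) (\<lambda>e. t * f e) = of_rat n" using pos by (simp add: t_def)
  ultimately show ?thesis
    using x unfolding has_rainbow_fractional_matching_def m_def[symmetric]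
    by (intro exI[of _ m] exI[of _ x] exI[of _ id] exI[of _ "\<lambda>e. t * f e"]) auto
qed

end
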